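(* Let $k\ge 2$ be an integer, let $F_k$ be the free group on $k$ generators, and let $\mathcal{K}$ be a finite set of nonempty finite radial subsets of $F_k$. Then $\mathcal{K}$ has the Pompeiu property (with respect to the class of all complex-valued functions on $F_k$) if and only if $\bigcap_{K \in \mathcal{K}} Z(\chi_K) = \emptyset$.
   Context: Pompeiu property: a finite collection $\mathcal{K}$ of finite subsets of a group $G$ has the Pompeiu property if $f=0$ is the only function $f\colon G\to\mathbb{C}$ such that $\sum_{x\in gK} f(x)=0$ for all $K\in\mathcal{K}$ and all $g\in G$. For $x\in F_k$, $|x|$ is the length of the reduced word representing $x$ in the free generators and their inverses. For an integer $n\ge 0$, $E_n=\{x\in F_k : |x|=n\}$. A subset of $F_k$ is radial if it is a union of sets of the form $E_n$. $\mathbb{C}F_k$ is the complex group ring (finitely supported functions $F_k\to\mathbb{C}$). $\chi_K\in\mathbb{C}F_k$ denotes the characteristic function of a finite set $K$, and $\chi_n=\sum_{|x|=n}x$ that of $E_n$. $(\mathbb{C}F_k)_r$ is the set of radial elements of $\mathbb{C}F_k$ (those whose value at $x$ depends only on $|x|$); every element of it is a finite sum $\sum_{j=0}^m a_j\chi_j$ with $a_j\in\mathbb{C}$. Polynomials $p_n$: $p_0(z)=1$, $p_1(z)=z$, $p_2(z)=z^2-2k$, and $p_{n+1}(z)=zp_n(z)-(2k-1)p_{n-1}(z)$ for $n\ge 2$. For $\alpha=\sum_{j=0}^m a_j\chi_j\in(\mathbb{C}F_k)_r$, $\hat\alpha(z)=\sum_{j=0}^m a_jp_j(z)$ for $z\in\mathbb{C}$,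 and $Z(\alpha)=\{z\in\mathbb{C}:\hat\alpha(z)=0\}$. The intersection is taken inside $\mathbb{C}$. *)

theory Defs
  imports
    Complex_Main
    "HOL-Algebra.Coset"
    "HOL-Library.Indicator_Function"
    "HOL-Computational_Algebra.Polynomial"
begin

definition pompeiu_property :: "('a, 'b) monoid_scheme \<Rightarrow> 'a set set \<Rightarrow> bool" where
  "pompeiu_property G \<K> \<longleftrightarrow>
     (\<forall>f :: 'a \<Rightarrow> complex.
        (\<forall>K\<in>\<K>. \<forall>g\<in>carrier G. (\<Sum>x\<in>(g <#\<^bsub>G\<^esub> K). f x) = 0)
        \<longrightarrow> (\<forall>x\<in>carrier G. f x = 0))"

text \<open>
  Elements are the reduced words in the letters \<open>(i, True)\<close> (the generator with index
  \<open>i < k\<close>) and \<open>(i, False)\<close> (its inverse).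
\<close>

type_synonym letter = "nat \<times> bool"
type_synonym word = "letter list"

definition inv_letter :: "letter \<Rightarrow> letter" where
  "inv_letter x = (fst x, \<not> snd x)"

definition reduced :: "word \<Rightarrow> bool" where
  "reduced w \<longleftrightarrow> successively (\<lambda>x y. y \<noteq> inv_letter x) w"

fun cons_red :: "letter \<Rightarrow> word \<Rightarrow> word" where
  "cons_red x [] = [x]"
| "cons_red x (y # w) = (if y = inv_letter x then w else x # y # w)"

definition free_group :: "nat \<Rightarrow> word monoid" where
  "free_group k =
     \<lparr>carrier = {w. reduced w \<and> set w \<subseteq> {..<k} \<times> UNIV},
      monoid.mult = (\<lambda>u v. foldr cons_red u v),
      one = []\<rparr>"

lemma carrier_free_group:
  "carrier (free_group k) = {w. reduced w \<and> set w \<subseteq> {..<k} \<times> UNIV}"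
  by (simp add: free_group_def)

lemma mult_free_group: "u \<otimes>\<^bsub>free_group k\<^esub> v = foldr cons_red u v"
  by (simp add: free_group_def)

lemma one_free_group: "\<one>\<^bsub>free_group k\<^esub> = []"
  by (simp add: free_group_def)

lemma inv_letter_inv_letter [simp]: "inv_letter (inv_letter x) = x"
  by (simp add: inv_letter_def)

lemma inv_letter_neq [simp]: "inv_letter x \<noteq> x" "x \<noteq> inv_letter x"
  by (cases x; simp add: inv_letter_def)+

lemma inv_letter_mem [simp]: "inv_letter x \<in> {..<k} \<times> UNIV \<longleftrightarrow> x \<in> {..<k} \<times> UNIV"
  by (cases x) (simp add: inv_letter_def)

lemma reduced_Nil [simp]: "reduced []"
  by (simp add: reduced_def)

lemma reduced_Cons: "reduced (x # w) \<longleftrightarrow> reduced w \<and> (w = [] \<or> hd w \<noteq> inv_letter x)"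
  by (cases w) (auto simp: reduced_def)

lemma reduced_cons_red: "reduced w \<Longrightarrow> reduced (cons_red x w)"
  by (cases w) (auto simp: reduced_Cons)

lemma set_cons_red: "set (cons_red x w) \<subseteq> insert x (set w)"
  by (cases w) auto

lemma cons_red_reduced: "reduced (x # w) \<Longrightarrow> cons_red x w = x # w"
  by (cases w) (auto simp: reduced_Cons)

lemma cons_red_inv: "reduced w \<Longrightarrow> cons_red x (cons_red (inv_letter x) w) = w"
  by (cases w; cases "tl w") (auto simp: reduced_Cons)

lemma reduced_foldr: "reduced v \<Longrightarrow> reduced (foldr cons_red u v)"
  by (induction u) (auto intro: reduced_cons_red)

lemma set_foldr: "set (foldr cons_red u v) \<subseteq> set u \<union> set v"
proof (induction u)
  case (Cons x u)
  then show ?case using set_cons_red[of x "foldr cons_red u v"] by auto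
qed simp

lemma foldr_Nil: "reduced u \<Longrightarrow> foldr cons_red u [] = u"
  by (induction u) (auto simp: reduced_Cons cons_red_reduced)

lemma foldr_cons_red:
  assumes "reduced v"
  shows "foldr cons_red (cons_red x u) v = cons_red x (foldr cons_red u v)"
proof (cases u)
  case (Cons y u')
  then show ?thesis
    using cons_red_inv[OF reduced_foldr[OF assms], of x u'] by auto
qed simp

lemma foldr_assoc:
  assumes "reduced w"
  shows "foldr cons_red (foldr cons_red u v) w = foldr cons_red u (foldr cons_red v w)"
  by (induction u) (auto simp: foldr_cons_red[OF assms])

lemma foldr_inverse:
  assumes "reduced v"
  shows "foldr cons_red (map inv_letter (rev u)) (foldr cons_red u v) = v"
  using assms
proof (induction u)
  case (Cons x u)
  have "cons_red (inv_letter x) (cons_red x (foldr cons_red u v)) = foldr cons_red u v"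
    using cons_red_inv[OF reduced_foldr[OF Cons.prems], of "inv_letter x" u] by simp
  then show ?case using Cons by simp
qed simp

lemma group_free_group: "group (free_group k)"
proof (rule groupI)
  show "\<And>x y. x \<in> carrier (free_group k) \<Longrightarrow> y \<in> carrier (free_group k) \<Longrightarrow>
      x \<otimes>\<^bsub>free_group k\<^esub> y \<in> carrier (free_group k)"
    using set_foldr unfolding carrier_free_group mult_free_group
    by (fastforce intro: reduced_foldr)
next
  fix u assume u: "u \<in> carrier (free_group k)"
  define v where "v = foldr cons_red (map inv_letter (rev u)) []"
  have "set v \<subseteq> {..<k} \<times> UNIV"
  proof
    fix x assume "x \<in> set v"
    then have "x \<in> inv_letter ` set u"
      using set_foldr[of "map inv_letter (rev u)" "[]"] unfolding v_def by auto
    then show "x \<in> {..<k} \<times> UNIV"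
      using u inv_letter_mem by (auto simp: carrier_free_group simp del: mem_Sigma_iff)
  qed
  then have "v \<in> carrier (free_group k)"
    by (simp add: carrier_free_group v_def reduced_foldr)
  moreover have "v \<otimes>\<^bsub>free_group k\<^esub> u = \<one>\<^bsub>free_group k\<^esub>"
    using u foldr_inverse[of "[]" u]
    by (simp add: carrier_free_group mult_free_group one_free_group v_def foldr_assoc foldr_Nil)
  ultimately show "\<exists>v\<in>carrier (free_group k). v \<otimes>\<^bsub>free_group k\<^esub> u = \<one>\<^bsub>free_group k\<^esub>"
    by blast
qed (auto simp: carrier_free_group mult_free_group one_free_group foldr_assoc)

fun letter_val :: "('a, 'b) monoid_scheme \<Rightarrow> (nat \<Rightarrow> 'a) \<Rightarrow> letter \<Rightarrow> 'a" where
  "letter_val H g (i, b) = (if b then g i else inv\<^bsub>H\<^esub> (g i))"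

text \<open>The universal property of the free group on the generators \<open>[(i, True)]\<close>, \<open>i < k\<close>.\<close>

lemma free_group_lift:
  fixes H (structure)
  assumes H: "group H" and g: "\<And>i. i < k \<Longrightarrow> g i \<in> carrier H"
  shows "\<exists>\<phi> \<in> hom (free_group k) H. \<forall>i<k. \<phi> [(i, True)] = g i"
proof
  interpret group H by fact
  define \<phi> where "\<phi> = (\<lambda>w. foldr (\<lambda>x h. letter_val H g x \<otimes> h) w \<one>)"
  have lv: "letter_val H g x \<in> carrier H" if "x \<in> {..<k} \<times> UNIV" for x
    using that g by (cases x) auto
  have phi_closed: "\<phi> w \<in> carrier H" if "set w \<subseteq> {..<k} \<times> UNIV" for w
    using that unfolding \<phi>_def by (induction w) (auto intro!: m_closed lv simp: mem_Times_iff)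
  have phi_Cons: "\<phi> (x # w) = letter_val H g x \<otimes> \<phi> w" for x w
    by (simp add: \<phi>_def)
  have lv_inv: "letter_val H g x \<otimes> (letter_val H g (inv_letter x) \<otimes> h) = h"
    if "x \<in> {..<k} \<times> UNIV" "h \<in> carrier H" for x h
    using that g by (cases x) (auto simp: inv_letter_def m_assoc[symmetric])
  have phi_cons_red: "\<phi> (cons_red x w) = letter_val H g x \<otimes> \<phi> w"
    if "x \<in> {..<k} \<times> UNIV" "set w \<subseteq> {..<k} \<times> UNIV" for x w
    using that lv_inv[OF that(1) phi_closed] by (cases w) (auto simp: phi_Cons)
  have phi_mult: "\<phi> (foldr cons_red u v) = \<phi> u \<otimes> \<phi> v"
    if "set u \<subseteq> {..<k} \<times> UNIV" "set v \<subseteq> {..<k} \<times> UNIV" for u v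
    using that(1)
  proof (induction u)
    case Nil
    then show ?case using phi_closed[OF that(2)] by (simp add: \<phi>_def)
  next
    case (Cons x u)
    then have x: "x \<in> {..<k} \<times> UNIV" and u: "set u \<subseteq> {..<k} \<times> UNIV" by auto
    have "set (foldr cons_red u v) \<subseteq> {..<k} \<times> UNIV"
      using set_foldr[of u v] u that(2) by blast
    then have "\<phi> (foldr cons_red (x # u) v) = letter_val H g x \<otimes> \<phi> (foldr cons_red u v)"
      using phi_cons_red[OF x] by simp
    then show ?case
      using Cons.IH[OF u] lv[OF x] phi_closed[OF u] phi_closed[OF that(2)]
      by (simp add: phi_Cons m_assoc)
  qed
  show "\<phi> \<in> hom (free_group k) H"
    by (auto simp: hom_def carrier_free_group mult_free_group intro!: phi_closed phi_mult)
  show "\<forall>i<k. \<phi> [(i, True)] = g i"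
    using g by (simp add: \<phi>_def)
qed

lemma free_group_hom_unique:
  assumes H: "group H" and \<phi>: "\<phi> \<in> hom (free_group k) H" and \<psi>: "\<psi> \<in> hom (free_group k) H"
    and eq: "\<And>i. i < k \<Longrightarrow> \<phi> [(i, True)] = \<psi> [(i, True)]"
    and w: "w \<in> carrier (free_group k)"
  shows "\<phi> w = \<psi> w"
proof -
  let ?F = "free_group k"
  interpret F: group ?F by (rule group_free_group)
  interpret P: group_hom ?F H \<phi>
    using H \<phi> by (simp add: group_hom_def group_hom_axioms_def F.group_axioms)
  interpret Q: group_hom ?F H \<psi>
    using H \<psi> by (simp add: group_hom_def group_hom_axioms_def F.group_axioms)
  have gen: "[(i, b)] \<in> carrier ?F" if "i < k" for i b
    using that by (simp add: carrier_free_group reduced_Cons)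
  have inv: "[(i, False)] = inv\<^bsub>?F\<^esub> [(i, True)]" if "i < k" for i
    using F.inv_equality[of "[(i, False)]" "[(i, True)]"] gen[OF that]
    by (simp add: mult_free_group one_free_group inv_letter_def)
  have letter: "\<phi> [(i, b)] = \<psi> [(i, b)]" if "i < k" for i b
    using eq[OF that] gen[OF that] inv[OF that] by (cases b) auto
  show ?thesis
    using w
  proof (induction w)
    case Nil
    then show ?case using P.hom_one Q.hom_one by (simp add: one_free_group)
  next
    case (Cons x w)
    obtain i b where x: "x = (i, b)" by (cases x)
    have i: "i < k" and w: "w \<in> carrier ?F" and red: "reduced (x # w)"
      using Cons.prems by (auto simp: carrier_free_group reduced_Cons x)
    have "x # w = [(i, b)] \<otimes>\<^bsub>?F\<^esub> w"
      using cons_red_reduced[OF red] by (simp add: mult_free_group x)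
    then show ?case
      using Cons.IH[OF w] letter[OF i, of b] gen[OF i, of b] w by simp
  qed
qed

text \<open>The elements of \<open>free_group k\<close> are reduced words, so \<open>|x|\<close> is \<open>length x\<close>.\<close>

definition sphere_F :: "nat \<Rightarrow> nat \<Rightarrow> word set" where
  "sphere_F k n = {x \<in> carrier (free_group k). length x = n}"

definition radial_set :: "nat \<Rightarrow> word set \<Rightarrow> bool" where
  "radial_set k K \<longleftrightarrow> (\<exists>N. K = (\<Union>n\<in>N. sphere_F k n))"

text \<open>
  An element of the group ring is a finitely supported function on \<open>carrier (free_group k)\<close>,
  extended by \<open>0\<close> to all lists of letters. The characteristic function of \<open>K\<close> is
  \<open>indicator K\<close>.
\<close>

definition radial_ring :: "nat \<Rightarrow> (word \<Rightarrow> complex) set" where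
  "radial_ring k =
     {\<alpha>. finite {x. \<alpha> x \<noteq> 0} \<and> {x. \<alpha> x \<noteq> 0} \<subseteq> carrier (free_group k) \<and>
         (\<forall>x\<in>carrier (free_group k). \<forall>y\<in>carrier (free_group k).
            length x = length y \<longrightarrow> \<alpha> x = \<alpha> y)}"

fun p_poly :: "nat \<Rightarrow> nat \<Rightarrow> complex poly" where
  "p_poly k 0 = 1"
| "p_poly k (Suc 0) = [:0, 1:]"
| "p_poly k (Suc (Suc 0)) = [:0, 1:]\<^sup>2 - [:2 * of_nat k:]"
| "p_poly k (Suc (Suc (Suc n))) =
     [:0, 1:] * p_poly k (Suc (Suc n)) - [:2 * of_nat k - 1:] * p_poly k (Suc n)"

text \<open>
  \<open>radial_coeff k \<alpha> j\<close> is the coefficient \<open>a\<^sub>j\<close> of the expansion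
  \<open>\<alpha> = (\<Sum>j\<le>m. a\<^sub>j \<chi>\<^sub>j)\<close> of a radial \<open>\<alpha>\<close>, i.e. the common value of \<open>\<alpha>\<close> on the sphere of
  radius \<open>j\<close>; it is meaningful for \<open>\<alpha> \<in> radial_ring k\<close> and \<open>k \<ge> 1\<close>.
\<close>

definition radial_coeff :: "nat \<Rightarrow> (word \<Rightarrow> complex) \<Rightarrow> nat \<Rightarrow> complex" where
  "radial_coeff k \<alpha> j = (THE c. \<forall>x\<in>sphere_F k j. \<alpha> x = c)"

definition radial_transform :: "nat \<Rightarrow> (word \<Rightarrow> complex) \<Rightarrow> complex \<Rightarrow> complex" where
  "radial_transform k \<alpha> z =
     (\<Sum>j | radial_coeff k \<alpha> j \<noteq> 0. radial_coeff k \<alpha> j * poly (p_poly k j) z)"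

definition zero_set :: "nat \<Rightarrow> (word \<Rightarrow> complex) \<Rightarrow> complex set" where
  "zero_set k \<alpha> = {z. radial_transform k \<alpha> z = 0}"

lemma finite_sphere_F: "finite (sphere_F k n)"
proof (rule finite_subset)
  show "sphere_F k n \<subseteq> {w. set w \<subseteq> {..<k} \<times> UNIV \<and> length w = n}"
    by (auto simp: sphere_F_def carrier_free_group)
  show "finite {w. set w \<subseteq> {..<k} \<times> (UNIV :: bool set) \<and> length w = n}"
    by (rule finite_lists_length_eq) simp
qed

lemma sphere_F_nonempty:
  assumes "k \<ge> 1"
  shows "sphere_F k n \<noteq> {}"
proof -
  have "reduced (replicate n (0, True))"
    by (induction n) (auto simp: reduced_Cons inv_letter_def hd_replicate)
  then have "replicate n (0, True) \<in> sphere_F k n"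
    using assms by (auto simp: sphere_F_def carrier_free_group)
  then show ?thesis by blast
qed

lemma radial_coeff_eq:
  assumes "k \<ge> 1" and "\<And>x. x \<in> sphere_F k j \<Longrightarrow> \<alpha> x = c"
  shows "radial_coeff k \<alpha> j = c"
  using assms sphere_F_nonempty[OF assms(1), of j] unfolding radial_coeff_def
  by (intro the_equality) auto

lemma sum_spheres:
  assumes "x \<in> carrier (free_group k)"
  shows "(\<Sum>j\<le>m. a j * indicator (sphere_F k j) x) = (if length x \<le> m then a (length x) else (0 :: complex))"
proof -
  have "(\<Sum>j\<le>m. a j * indicator (sphere_F k j) x) = (\<Sum>j\<le>m. if j = length x then a j else 0)"
    using assms by (intro sum.cong) (auto simp: sphere_F_def indicator_def)
  then show ?thesis by (simp add: sum.delta')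
qed

lemma radial_ring_expansion:
  "\<alpha> \<in> radial_ring k \<longleftrightarrow> (\<exists>a m. \<alpha> = (\<lambda>x. \<Sum>j\<le>m. a j * indicator (sphere_F k j) x))"
proof
  assume \<alpha>: "\<alpha> \<in> radial_ring k"
  define m where "m = Max (insert 0 (length ` {x. \<alpha> x \<noteq> 0}))"
  define a where "a = (\<lambda>j. \<alpha> (SOME x. x \<in> sphere_F k j))"
  have fin: "finite {x. \<alpha> x \<noteq> 0}" using \<alpha> by (simp add: radial_ring_def)
  have "\<alpha> x = (\<Sum>j\<le>m. a j * indicator (sphere_F k j) x)" for x
  proof (cases "x \<in> carrier (free_group k)")
    case True
    then have "x \<in> sphere_F k (length x)" by (simp add: sphere_F_def)
    then have "(SOME y. y \<in> sphere_F k (length x)) \<in> sphere_F k (length x)" by (rule someI)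
    then have "a (length x) = \<alpha> x"
      using \<alpha> True unfolding a_def radial_ring_def sphere_F_def by blast
    moreover have "length x \<le> m" if "\<alpha> x \<noteq> 0"
      unfolding m_def using fin that by (intro Max_ge) auto
    ultimately show ?thesis using sum_spheres[OF True, of a m] by auto
  next
    case False
    then have "\<alpha> x = 0" using \<alpha> by (auto simp: radial_ring_def)
    then show ?thesis using False by (simp add: sphere_F_def)
  qed
  then show "\<exists>a m. \<alpha> = (\<lambda>x. \<Sum>j\<le>m. a j * indicator (sphere_F k j) x)" by blast
next
  assume "\<exists>a m. \<alpha> = (\<lambda>x. \<Sum>j\<le>m. a j * indicator (sphere_F k j) x)"
  then obtain a m where \<alpha>: "\<alpha> = (\<lambda>x. \<Sum>j\<le>m. a j * indicator (sphere_F k j) x)" by blast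
  have sub: "{x. \<alpha> x \<noteq> 0} \<subseteq> (\<Union>j\<le>m. sphere_F k j)"
  proof
    fix x assume "x \<in> {x. \<alpha> x \<noteq> 0}"
    then have "\<exists>j\<in>{..m}. a j * indicator (sphere_F k j) x \<noteq> 0"
      unfolding \<alpha> by (metis (mono_tags, lifting) mem_Collect_eq sum.neutral)
    then show "x \<in> (\<Union>j\<le>m. sphere_F k j)" by (auto simp: indicator_def split: if_splits)
  qed
  have "finite {x. \<alpha> x \<noteq> 0}"
    by (rule finite_subset[OF sub]) (simp add: finite_sphere_F)
  moreover have "{x. \<alpha> x \<noteq> 0} \<subseteq> carrier (free_group k)"
    using sub by (auto simp: sphere_F_def)
  ultimately show "\<alpha> \<in> radial_ring k"
    by (auto simp: radial_ring_def \<alpha> sum_spheres)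
qed

lemma radial_transform_sum:
  assumes "k \<ge> 1"
  shows "radial_transform k (\<lambda>x. \<Sum>j\<le>m. a j * indicator (sphere_F k j) x) z
           = (\<Sum>j\<le>m. a j * poly (p_poly k j) z)"
proof -
  define \<alpha> where "\<alpha> = (\<lambda>x. \<Sum>j\<le>m. a j * indicator (sphere_F k j) x)"
  have coeff: "radial_coeff k \<alpha> j = (if j \<le> m then a j else 0)" for j
    using assms by (intro radial_coeff_eq) (auto simp: \<alpha>_def sphere_F_def[of k j] sum_spheres)
  have "radial_transform k \<alpha> z
          = (\<Sum>j\<in>{j. j \<le> m \<and> a j \<noteq> 0}. a j * poly (p_poly k j) z)"
    unfolding radial_transform_def coeff by (intro sum.cong) auto
  also have "\<dots> = (\<Sum>j\<le>m. a j * poly (p_poly k j) z)"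
    by (intro sum.mono_neutral_left) auto
  finally show ?thesis by (simp add: \<alpha>_def)
qed

lemma p_poly_rec:
  assumes "n \<ge> 2"
  shows "poly (p_poly k (n + 1)) z
           = z * poly (p_poly k n) z - (2 * of_nat k - 1) * poly (p_poly k (n - 1)) z"
proof -
  obtain l where "n = Suc (Suc l)" using assms by (metis Suc_le_D numeral_2_eq_2 Suc_le_mono)
  then show ?thesis by simp
qed

lemma indicator_radial_ring:
  assumes "radial_set k K" and "finite K"
  shows "indicator K \<in> radial_ring k"
proof -
  have eq: "indicator K x \<noteq> (0 :: complex) \<longleftrightarrow> x \<in> K" for x by (simp add: indicator_def)
  show ?thesis
    using assms unfolding radial_ring_def mem_Collect_eq eq
    by (auto simp: radial_set_def sphere_F_def indicator_def)
qed

end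

theory Submission
  imports Defs "HOL-Computational_Algebra.Fundamental_Theorem_Algebra"
begin

text \<open>
  Let \<open>T f g\<close> be the sum of \<open>f\<close> over the neighbours \<open>g s\<close> of \<open>g\<close> in the Cayley tree. The operator
  \<open>f \<mapsto> (g \<mapsto> \<Sum>x\<in>E\<^sub>n. f (g x))\<close> equals \<open>p\<^sub>n(T)\<close>, so the sums of \<open>f\<close> over the translates
  of \<open>K\<close> are the values of \<open>P\<^sub>K(T) f\<close>, where \<open>P\<^sub>K\<close> is the polynomial \<open>\<Sum>p\<^sub>n\<close> over the
  radii \<open>n\<close> occurring in \<open>K\<close>. If the \<open>P\<^sub>K\<close> have no common zero then they generate the unit
  ideal, and \<open>P\<^sub>K(T) f = 0\<close> for all \<open>K\<close> forces \<open>f = 0\<close>. Conversely, every complex number \<open>z\<close> is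
  the eigenvalue of a radial eigenfunction \<open>f\<close> of \<open>T\<close> with \<open>f 1 = 1\<close>; then
  \<open>P\<^sub>K(T) f = P\<^sub>K(z) f\<close>, which vanishes for all \<open>K\<close> at a common zero \<open>z\<close>.
\<close>

subsection \<open>Spheres in the free group\<close>

definition letters :: "nat \<Rightarrow> letter set" where
  "letters k = {..<k} \<times> UNIV"

lemma finite_letters [simp]: "finite (letters k)"
  by (simp add: letters_def)

lemma card_letters: "card (letters k) = 2 * k"
  by (simp add: letters_def card_cartesian_product)

lemma inv_letter_letters [simp]: "inv_letter s \<in> letters k \<longleftrightarrow> s \<in> letters k"
  by (cases s) (auto simp: letters_def inv_letter_def)

lemma sphere_F_0: "sphere_F k 0 = {[]}"
  by (auto simp: sphere_F_def carrier_free_group)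

text \<open>Each nonempty reduced word is stored as a pair (first letter, rest), so that sums over a
  sphere and sums over pairs (letter, word) can be compared.\<close>

definition extensions :: "nat \<Rightarrow> nat \<Rightarrow> (letter \<times> word) set" where
  "extensions k n = {(s, w). s \<in> letters k \<and> w \<in> sphere_F k n \<and> reduced (s # w)}"

lemma finite_extensions [simp]: "finite (extensions k n)"
  by (rule finite_subset[of _ "letters k \<times> sphere_F k n"])
    (auto simp: extensions_def finite_sphere_F)

lemma bij_betw_extensions: "bij_betw (\<lambda>(s, w). s # w) (extensions k n) (sphere_F k (Suc n))"
proof (rule bij_betw_imageI)
  show "(\<lambda>(s, w). s # w) ` extensions k n = sphere_F k (Suc n)"
  proof (intro equalityI subsetI)
    fix x assume x: "x \<in> sphere_F k (Suc n)"
    then obtain s w where "x = s # w" by (cases x) (auto simp: sphere_F_def)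
    with x have "(s, w) \<in> extensions k n"
      by (auto simp: extensions_def sphere_F_def carrier_free_group letters_def reduced_Cons)
    then show "x \<in> (\<lambda>(s, w). s # w) ` extensions k n" using \<open>x = s # w\<close> by force
  qed (auto simp: extensions_def sphere_F_def carrier_free_group letters_def)
qed (auto simp: inj_on_def)

text \<open>The only letter that cannot precede a nonempty reduced word is the inverse of its first
  letter.\<close>

lemma card_extending_letters:
  assumes "reduced w" "set w \<subseteq> letters k"
  shows "card {s \<in> letters k. reduced (s # w)} = (if w = [] then 2 * k else 2 * k - 1)"
proof (cases w)
  case Nil
  then show ?thesis by (simp add: card_letters reduced_Cons)
next
  case (Cons t v)
  then have "{s \<in> letters k. reduced (s # w)} = letters k - {inv_letter t}"
    using assms(1) by (auto simp: reduced_Cons)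
  then show ?thesis using assms(2) Cons by (simp add: card_letters)
qed

text \<open>Splits the products \<open>s x\<close> according to whether \<open>s\<close> cancels the first letter of \<open>x\<close>.\<close>

lemma sum_cons_red_sphere:
  fixes h :: "word \<Rightarrow> complex"
  assumes "k \<ge> 1"
  shows "(\<Sum>s\<in>letters k. \<Sum>x\<in>sphere_F k (Suc n). h (cons_red s x))
     = (\<Sum>x\<in>sphere_F k (Suc (Suc n)). h x)
       + (if n = 0 then 2 * of_nat k else 2 * of_nat k - 1) * (\<Sum>w\<in>sphere_F k n. h w)"
proof -
  define C where "C = {(s, x). s \<in> letters k \<and> x \<in> sphere_F k (Suc n) \<and> \<not> reduced (s # x)}"
  define H where "H = (\<lambda>(s, x). h (cons_red s x))"
  \<comment> \<open>\<open>C\<close> collects the cancelling pairs: there x = t w and s is the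
    inverse of t, so that the product is w.\<close>
  have "bij_betw (\<lambda>(t, w). (inv_letter t, t # w)) (extensions k n) C"
  proof (rule bij_betw_imageI)
    show "(\<lambda>(t, w). (inv_letter t, t # w)) ` extensions k n = C"
    proof (intro equalityI subsetI)
      fix y assume y: "y \<in> C"
      then obtain s t w where tw: "y = (s, t # w)"
        by (cases y, cases "snd y") (auto simp: C_def sphere_F_def)
      with y have "s = inv_letter t"
        by (auto simp: C_def sphere_F_def carrier_free_group reduced_Cons)
      moreover have "(t, w) \<in> extensions k n"
        using y by (auto simp: tw C_def extensions_def sphere_F_def carrier_free_group
            letters_def reduced_Cons)
      ultimately show "y \<in> (\<lambda>(t, w). (inv_letter t, t # w)) ` extensions k n"
        using tw by force
    next
      fix y assume "y \<in> (\<lambda>(t, w). (inv_letter t, t # w)) ` extensions k n"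
      then obtain t w where y: "y = (inv_letter t, t # w)" and tw: "(t, w) \<in> extensions k n"
        by auto
      then have "t # w \<in> sphere_F k (Suc n)"
        using bij_betwE[OF bij_betw_extensions] by fastforce
      then show "y \<in> C" using y tw by (simp add: C_def extensions_def reduced_Cons)
    qed
  qed (auto simp: inj_on_def)
  then have "(\<Sum>p\<in>C. H p) = (\<Sum>(t, w)\<in>extensions k n. h w)"
    by (subst sum.reindex_bij_betw[symmetric]) (auto simp: H_def split_beta)
  \<comment> \<open>Grouping by w turns the multiplicity of \<open>h w\<close> into the number of
    letters that may precede w.\<close>
  also have "extensions k n = (\<lambda>(w, t). (t, w)) ` (SIGMA w:sphere_F k n. {t \<in> letters k. reduced (t # w)})"
    by (auto simp: extensions_def)
  also have "(\<Sum>(t, w)\<in>\<dots>. h w)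
      = (\<Sum>(w, t)\<in>(SIGMA w:sphere_F k n. {t \<in> letters k. reduced (t # w)}). h w)"
    by (subst sum.reindex) (auto simp: inj_on_def split_beta)
  also have "\<dots> = (\<Sum>w\<in>sphere_F k n. \<Sum>t\<in>{t \<in> letters k. reduced (t # w)}. h w)"
    by (subst sum.Sigma) (auto simp: finite_sphere_F)
  also have "\<dots> = (\<Sum>w\<in>sphere_F k n. (if n = 0 then 2 * of_nat k else 2 * of_nat k - 1) * h w)"
  proof (rule sum.cong)
    fix w assume w: "w \<in> sphere_F k n"
    then have "card {t \<in> letters k. reduced (t # w)} = (if n = 0 then 2 * k else 2 * k - 1)"
      by (subst card_extending_letters) (auto simp: sphere_F_def carrier_free_group letters_def)
    then show "(\<Sum>t\<in>{t \<in> letters k. reduced (t # w)}. h w)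
        = (if n = 0 then 2 * of_nat k else 2 * of_nat k - 1) * h w"
      using assms by (simp add: of_nat_diff)
  qed simp
  finally have cancel: "(\<Sum>p\<in>C. H p)
      = (if n = 0 then 2 * of_nat k else 2 * of_nat k - 1) * (\<Sum>w\<in>sphere_F k n. h w)"
    by (simp add: sum_distrib_left)
  have "(\<Sum>p\<in>extensions k (Suc n). H p) = (\<Sum>(s, w)\<in>extensions k (Suc n). h (s # w))"
    by (rule sum.cong) (auto simp: H_def extensions_def cons_red_reduced)
  also have "\<dots> = (\<Sum>x\<in>sphere_F k (Suc (Suc n)). h x)"
    by (subst sum.reindex_bij_betw[OF bij_betw_extensions, symmetric]) (auto simp: split_beta)
  finally have grow: "(\<Sum>p\<in>extensions k (Suc n). H p) = (\<Sum>x\<in>sphere_F k (Suc (Suc n)). h x)" .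
  have "finite C"
    by (rule finite_subset[of _ "letters k \<times> sphere_F k (Suc n)"])
      (auto simp: C_def finite_sphere_F)
  moreover have "letters k \<times> sphere_F k (Suc n) = extensions k (Suc n) \<union> C"
    by (auto simp: extensions_def C_def)
  moreover have "extensions k (Suc n) \<inter> C = {}"
    by (auto simp: extensions_def C_def)
  ultimately have "(\<Sum>p\<in>letters k \<times> sphere_F k (Suc n). H p)
      = (\<Sum>p\<in>extensions k (Suc n). H p) + (\<Sum>p\<in>C. H p)"
    by (simp add: sum.union_disjoint)
  then show ?thesis
    by (simp add: sum.cartesian_product H_def[symmetric] grow cancel)
qed

subsection \<open>Averaging operators\<close>

definition sphere_sum :: "nat \<Rightarrow> nat \<Rightarrow> (word \<Rightarrow> complex) \<Rightarrow> word \<Rightarrow> complex" where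
  "sphere_sum k n f g = (\<Sum>x\<in>sphere_F k n. f (foldr cons_red g x))"

definition nbr_sum :: "nat \<Rightarrow> (word \<Rightarrow> complex) \<Rightarrow> word \<Rightarrow> complex" where
  "nbr_sum k f g = (\<Sum>s\<in>letters k. f (foldr cons_red g [s]))"

definition poly_op :: "nat \<Rightarrow> complex poly \<Rightarrow> (word \<Rightarrow> complex) \<Rightarrow> word \<Rightarrow> complex" where
  "poly_op k p f g = (\<Sum>i\<le>degree p. coeff p i * (nbr_sum k ^^ i) f g)"

text \<open>The group is closed under right multiplication by letters. Functions here live on all
  lists, so this lemma, applied to differences, transfers equality on the group through the
  operator.\<close>

lemma nbr_sum_eq_0_on_carrier:
  assumes "\<And>g. g \<in> carrier (free_group k) \<Longrightarrow> f g = 0" "g \<in> carrier (free_group k)"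
  shows "nbr_sum k f g = 0"
  unfolding nbr_sum_def
proof (intro sum.neutral ballI assms(1))
  fix s assume "s \<in> letters k"
  then have "[s] \<in> carrier (free_group k)"
    by (simp add: carrier_free_group letters_def reduced_Cons)
  with assms(2) show "foldr cons_red g [s] \<in> carrier (free_group k)"
    using monoid.m_closed[OF group.is_monoid[OF group_free_group], of g k "[s]"]
    by (simp add: mult_free_group)
qed

lemma nbr_sum_sum:
  "nbr_sum k (\<lambda>x. \<Sum>i\<in>I. c i * f i x) g = (\<Sum>i\<in>I. c i * nbr_sum k (f i) g)"
  unfolding nbr_sum_def by (subst sum.swap) (simp add: sum_distrib_left)

lemma nbr_sum_add: "nbr_sum k (\<lambda>x. f x + g x) w = nbr_sum k f w + nbr_sum k g w"
  by (simp add: nbr_sum_def sum.distrib)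

lemma nbr_sum_mult: "nbr_sum k (\<lambda>x. c * f x) w = c * nbr_sum k f w"
  by (simp add: nbr_sum_def sum_distrib_left)

section \<open>Polynomials in the neighbour sum\<close>

lemma poly_op_0 [simp]: "poly_op k 0 f g = 0"
  by (simp add: poly_op_def)

text \<open>Horner's scheme; it lets the algebraic laws below be proved by induction on
  \<open>pCons\<close>.\<close>

lemma poly_op_pCons [simp]: "poly_op k (pCons a p) f g = a * f g + nbr_sum k (poly_op k p f) g"
proof (cases "p = 0")
  case True
  then show ?thesis by (simp add: poly_op_def nbr_sum_def)
next
  case False
  then have "poly_op k (pCons a p) f g
      = a * f g + (\<Sum>i\<le>degree p. coeff p i * nbr_sum k ((nbr_sum k ^^ i) f) g)"
    by (simp add: poly_op_def sum.atMost_Suc_shift del: sum.atMost_Suc)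
  also have "(\<Sum>i\<le>degree p. coeff p i * nbr_sum k ((nbr_sum k ^^ i) f) g)
      = nbr_sum k (poly_op k p f) g"
    unfolding poly_op_def nbr_sum_sum[symmetric] ..
  finally show ?thesis .
qed

lemma poly_op_add: "poly_op k (p + q) f g = poly_op k p f g + poly_op k q f g"
proof (induction p q arbitrary: g rule: poly_induct2)
  case (pCons a p b q)
  then have "poly_op k (p + q) f = (\<lambda>g. poly_op k p f g + poly_op k q f g)" by auto
  then show ?case by (simp add: nbr_sum_add algebra_simps)
qed simp

lemma poly_op_smult: "poly_op k (smult c p) f g = c * poly_op k p f g"
proof (induction p arbitrary: g)
  case (pCons a p)
  then have "poly_op k (smult c p) f = (\<lambda>g. c * poly_op k p f g)" by auto
  then show ?case by (simp add: nbr_sum_mult algebra_simps)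
qed simp

lemma poly_op_mult: "poly_op k (p * q) f = poly_op k p (poly_op k q f)"
proof (induction p)
  case (pCons a p)
  then show ?case by (auto simp: poly_op_add poly_op_smult)
qed auto

lemma poly_op_sum: "poly_op k (\<Sum>i\<in>I. p i) f g = (\<Sum>i\<in>I. poly_op k (p i) f g)"
  by (induction I rule: infinite_finite_induct) (auto simp: poly_op_add)

lemma poly_op_eq_0_on_carrier:
  assumes "\<And>g. g \<in> carrier (free_group k) \<Longrightarrow> f g = 0" "g \<in> carrier (free_group k)"
  shows "poly_op k p f g = 0"
  using assms(2)
proof (induction p arbitrary: g)
  case (pCons a p)
  then show ?case using assms(1) nbr_sum_eq_0_on_carrier by simp
qed simp

lemma poly_op_eigenfunction:
  assumes eig: "\<And>g. g \<in> carrier (free_group k) \<Longrightarrow> nbr_sum k f g = z * f g"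
    and "g \<in> carrier (free_group k)"
  shows "poly_op k p f g = poly p z * f g"
  using assms(2)
proof (induction p arbitrary: g)
  case (pCons a p)
  \<comment> \<open>The induction hypothesis holds only on the group, so it enters as the vanishing
    of a difference there.\<close>
  have "nbr_sum k (\<lambda>x. poly_op k p f x + (- poly p z) * f x) g = 0"
    using pCons by (intro nbr_sum_eq_0_on_carrier) auto
  then have "nbr_sum k (poly_op k p f) g = poly p z * nbr_sum k f g"
    unfolding nbr_sum_add nbr_sum_mult by simp
  then show ?case using pCons.prems by (simp add: eig algebra_simps)
qed simp

section \<open>Sphere sums as polynomials in the neighbour sum\<close>

lemma sphere_sum_0: "g \<in> carrier (free_group k) \<Longrightarrow> sphere_sum k 0 f g = f g"
  by (simp add: sphere_sum_def sphere_F_0 foldr_Nil carrier_free_group)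

lemma sphere_sum_1: "sphere_sum k (Suc 0) f = nbr_sum k (sphere_sum k 0 f)"
proof
  fix g
  have "sphere_F k (Suc 0) = (\<lambda>s. [s]) ` letters k"
    by (auto simp: sphere_F_def carrier_free_group letters_def reduced_Cons length_Suc_conv)
  then show "sphere_sum k (Suc 0) f g = nbr_sum k (sphere_sum k 0 f) g"
    by (simp add: sphere_sum_def nbr_sum_def sphere_F_0 foldr_assoc sum.reindex inj_on_def)
qed

text \<open>By associativity, (g s) x = g (s x); the products s x are then counted by length. This
  is the operator form of the recurrence of the \<open>p_poly k n\<close>.\<close>

lemma nbr_sum_sphere_sum:
  assumes "k \<ge> 1"
  shows "nbr_sum k (sphere_sum k (Suc n) f) g = sphere_sum k (Suc (Suc n)) f g
     + (if n = 0 then 2 * of_nat k else 2 * of_nat k - 1) * sphere_sum k n f g"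
proof -
  have "nbr_sum k (sphere_sum k (Suc n) f) g
      = (\<Sum>s\<in>letters k. \<Sum>x\<in>sphere_F k (Suc n). f (foldr cons_red g (cons_red s x)))"
    unfolding nbr_sum_def sphere_sum_def
    by (intro sum.cong) (auto simp: foldr_assoc sphere_F_def carrier_free_group)
  then show ?thesis
    by (simp add: sum_cons_red_sphere[OF assms, of "\<lambda>x. f (foldr cons_red g x)" n] sphere_sum_def)
qed

text \<open>Merges the two recurrences: the coefficient is 2k at n = 0, where all letters are
  available, and 2k - 1 afterwards.\<close>

lemma p_poly_Suc_Suc:
  "p_poly k (Suc (Suc n)) =
     pCons 0 (p_poly k (Suc n)) + smult (- (if n = 0 then 2 * of_nat k else 2 * of_nat k - 1)) (p_poly k n)"
  by (cases n) (simp_all add: power2_eq_square smult_diff_left)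

text \<open>
  The function \<open>sphere_sum k 0 f\<close> agrees with \<open>f\<close> on the group; in its place, \<open>f\<close> itself would
  restrict the identity to reduced words.
\<close>

lemma sphere_sum_eq_poly_op:
  assumes "k \<ge> 1"
  shows "sphere_sum k n f = poly_op k (p_poly k n) (sphere_sum k 0 f)"
proof (induction n rule: less_induct)
  case (less n)
  consider "n = 0" | "n = 1" | m where "n = Suc (Suc m)"
    by (metis One_nat_def not0_implies_Suc)
  then show ?case
  proof cases
    case 1
    have *: "poly_op k 0 h = (\<lambda>_. 0)" for h by auto
    show ?thesis by (auto simp: 1 one_pCons * nbr_sum_def)
  next
    case 2
    have *: "poly_op k 0 h = (\<lambda>_. 0)" for h by auto
    have "poly_op k 1 h = h" for h by (auto simp: one_pCons * nbr_sum_def)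
    then show ?thesis by (auto simp: 2 sphere_sum_1 one_pCons[symmetric])
  next
    case (3 m)
    have IH: "sphere_sum k m f = poly_op k (p_poly k m) (sphere_sum k 0 f)"
      "sphere_sum k (Suc m) f = poly_op k (p_poly k (Suc m)) (sphere_sum k 0 f)"
      by (rule less, simp add: 3)+
    show ?thesis
    proof
      fix g
      show "sphere_sum k n f g = poly_op k (p_poly k n) (sphere_sum k 0 f) g"
        unfolding 3 p_poly_Suc_Suc poly_op_add poly_op_smult poly_op_pCons IH[symmetric]
        using nbr_sum_sphere_sum[OF assms, of m f g] by simp
    qed
  qed
qed

subsection \<open>Spherical functions\<close>

text \<open>The eigenvalue equation for radial functions, solved for the value at the larger radius,
  with value 1 at the identity.\<close>

fun spherical :: "nat \<Rightarrow> complex \<Rightarrow> nat \<Rightarrow> complex" where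
  "spherical k z 0 = 1"
| "spherical k z (Suc 0) = z / (2 * of_nat k)"
| "spherical k z (Suc (Suc n)) = (z * spherical k z (Suc n) - spherical k z n) / (2 * of_nat k - 1)"

lemma foldr_cons_red_snoc:
  assumes "reduced (u @ [t])"
  shows "foldr cons_red (u @ [t]) [s] = (if s = inv_letter t then u else u @ [t, s])"
proof (cases "s = inv_letter t")
  case True
  then show ?thesis
    using assms by (simp add: foldr_Nil reduced_def successively_append_iff)
next
  case False
  then have "reduced ((u @ [t]) @ [s])"
    using assms by (auto simp: reduced_def successively_append_iff)
  then show ?thesis
    using foldr_Nil[of "(u @ [t]) @ [s]"] False by simp
qed

text \<open>The identity has 2k neighbours of length 1. Any other element has one shorter neighbour,
  reached by cancelling its last letter, and 2k - 1 longer ones.\<close>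

lemma nbr_sum_spherical:
  assumes k: "k \<ge> 1" and g: "g \<in> carrier (free_group k)"
  shows "nbr_sum k (\<lambda>x. spherical k z (length x)) g = z * spherical k z (length g)"
proof (cases g rule: rev_cases)
  case Nil
  then show ?thesis using k by (simp add: nbr_sum_def card_letters)
next
  case (snoc u t)
  then have t: "t \<in> letters k" and red: "reduced (u @ [t])"
    using g by (auto simp: carrier_free_group letters_def)
  \<comment> \<open>The recurrence of \<open>spherical\<close> divides by this number; it is nonzero
    by parity.\<close>
  have 1: "2 * of_nat k - 1 \<noteq> (0 :: complex)"
  proof
    assume "2 * of_nat k - 1 = (0 :: complex)"
    then have "of_nat (2 * k) = (of_nat 1 :: complex)" by simp
    then have "2 * k = 1" unfolding of_nat_eq_iff .
    then show False by presburger
  qed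
  have "nbr_sum k (\<lambda>x. spherical k z (length x)) g
      = spherical k z (length u)
        + (\<Sum>s\<in>letters k - {inv_letter t}. spherical k z (length (foldr cons_red g [s])))"
    using t red unfolding nbr_sum_def snoc
    by (subst sum.remove[of _ "inv_letter t"]) (auto simp: foldr_cons_red_snoc simp del: foldr_append)
  also have "(\<Sum>s\<in>letters k - {inv_letter t}. spherical k z (length (foldr cons_red g [s])))
      = (\<Sum>s\<in>letters k - {inv_letter t}. spherical k z (Suc (Suc (length u))))"
    using red unfolding snoc
    by (intro sum.cong) (auto simp: foldr_cons_red_snoc simp del: foldr_append)
  also have "\<dots> = (2 * of_nat k - 1) * spherical k z (Suc (Suc (length u)))"
    using t k by (simp add: card_letters of_nat_diff del: spherical.simps)
  also have "\<dots> = z * spherical k z (Suc (length u)) - spherical k z (length u)"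
    using 1 by simp
  finally show ?thesis by (simp add: snoc)
qed

subsection \<open>Radial sets\<close>

definition radii_poly :: "nat \<Rightarrow> nat set \<Rightarrow> complex poly" where
  "radii_poly k N = (\<Sum>n\<in>N. p_poly k n)"

text \<open>Spheres are nonempty, so every radius in the union is the length of an element of the
  finite set \<open>K\<close>.\<close>

lemma radial_setE:
  assumes "k \<ge> 1" "radial_set k K" "finite K"
  obtains N where "finite N" "K = (\<Union>n\<in>N. sphere_F k n)"
proof -
  obtain N where K: "K = (\<Union>n\<in>N. sphere_F k n)"
    using assms(2) by (auto simp: radial_set_def)
  have "N \<subseteq> length ` K"
  proof
    fix n assume "n \<in> N"
    moreover obtain x where "x \<in> sphere_F k n"
      using sphere_F_nonempty[OF assms(1)] by blast
    ultimately show "n \<in> length ` K" by (force simp: K sphere_F_def)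
  qed
  then have "finite N" using assms(3) by (rule finite_surj[rotated])
  then show ?thesis using K by (rule that)
qed

lemma zero_set_radial:
  assumes "k \<ge> 1" "finite N" "K = (\<Union>n\<in>N. sphere_F k n)"
  shows "zero_set k (indicator K) = {z. poly (radii_poly k N) z = 0}"
proof -
  \<comment> \<open>The inserted 0 keeps the maximum defined for empty \<open>N\<close>.\<close>
  define m where "m = Max (insert 0 N)"
  have N: "N \<subseteq> {..m}" using assms(2) by (auto simp: m_def)
  have "indicator K x = (\<Sum>j\<le>m. indicator N j * indicator (sphere_F k j) x :: complex)" for x
  proof (cases "x \<in> carrier (free_group k)")
    case True
    then show ?thesis using N by (auto simp: sum_spheres assms(3) indicator_def sphere_F_def)
  next
    case False
    then show ?thesis by (auto simp: assms(3) indicator_def sphere_F_def)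
  qed
  then have "indicator K = (\<lambda>x. \<Sum>j\<le>m. indicator N j * indicator (sphere_F k j) x :: complex)"
    by blast
  then have "radial_transform k (indicator K) z = (\<Sum>j\<le>m. indicator N j * poly (p_poly k j) z)" for z
    by (simp only: radial_transform_sum[OF assms(1)])
  also have "\<dots> z = poly (radii_poly k N) z" for z
    unfolding radii_poly_def poly_sum using N
    by (intro sum.mono_neutral_cong_right) (auto simp: indicator_def)
  finally show ?thesis by (simp add: zero_set_def)
qed

text \<open>Left translation is injective and spheres of different radii are disjoint, so the sum
  splits into sphere sums.\<close>

lemma sum_coset_radial:
  assumes "k \<ge> 1" "finite N" "K = (\<Union>n\<in>N. sphere_F k n)" "g \<in> carrier (free_group k)"
  shows "(\<Sum>x\<in>g <#\<^bsub>free_group k\<^esub> K. f x) = poly_op k (radii_poly k N) (sphere_sum k 0 f) g"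
proof -
  interpret group "free_group k" by (rule group_free_group)
  have "K \<subseteq> carrier (free_group k)" by (auto simp: assms(3) sphere_F_def)
  then have "inj_on (\<lambda>x. g \<otimes>\<^bsub>free_group k\<^esub> x) K"
    using assms(4) Units_l_cancel[of g] by (intro inj_onI) (auto simp: subset_iff)
  then have "(\<Sum>x\<in>g <#\<^bsub>free_group k\<^esub> K. f x) = (\<Sum>x\<in>K. f (foldr cons_red g x))"
    by (simp add: l_coset_def UNION_singleton_eq_range sum.reindex mult_free_group)
  also have "\<dots> = (\<Sum>n\<in>N. sphere_sum k n f g)"
    unfolding assms(3) sphere_sum_def using assms(2)
    by (intro sum.UNION_disjoint) (auto simp: finite_sphere_F, auto simp: sphere_F_def)
  also have "\<dots> = poly_op k (radii_poly k N) (sphere_sum k 0 f) g"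
    unfolding radii_poly_def poly_op_sum
    by (intro sum.cong refl fun_cong[OF sphere_sum_eq_poly_op[OF assms(1)]])
  finally show ?thesis .
qed

section \<open>Ideals of complex polynomials without a common zero\<close>

text \<open>A nonzero element \<open>d\<close> of least degree divides all of \<open>I\<close> by
  division with remainder. A zero of \<open>d\<close> would be a common zero, so \<open>d\<close> is
  a nonzero constant.\<close>

lemma complex_poly_ideal_unit:
  fixes I :: "complex poly set"
  assumes add: "\<And>p q. p \<in> I \<Longrightarrow> q \<in> I \<Longrightarrow> p + q \<in> I"
    and mult: "\<And>p q. q \<in> I \<Longrightarrow> p * q \<in> I"
    and no_zero: "\<And>z. \<exists>p\<in>I. poly p z \<noteq> 0"
  shows "1 \<in> I"
proof -
  have "\<exists>p. p \<in> I \<and> p \<noteq> 0" using no_zero[of 0] by auto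
  then obtain d where d: "d \<in> I" "d \<noteq> 0"
    and min: "\<And>p. p \<in> I \<Longrightarrow> p \<noteq> 0 \<Longrightarrow> degree d \<le> degree p"
    using ex_has_least_nat[of "\<lambda>p. p \<in> I \<and> p \<noteq> 0" _ degree] by blast
  have dvd: "d dvd p" if "p \<in> I" for p
  proof -
    have "p + (- (p div d)) * d \<in> I" using add mult d that by blast
    then have "p mod d \<in> I" by (simp add: minus_div_mult_eq_mod)
    then have "p mod d = 0" using min[of "p mod d"] degree_mod_less'[OF d(2), of p] by fastforce
    then show ?thesis by auto
  qed
  have "constant (poly d)"
  proof (rule ccontr)
    assume "\<not> constant (poly d)"
    then obtain z where "poly d z = 0" using fundamental_theorem_of_algebra by blast
    then show False using no_zero[of z] dvd by (force elim: dvdE)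
  qed
  then have "degree d = 0" by (simp add: constant_degree)
  then obtain c where c: "d = [:c:]" by (rule degree_eq_zeroE)
  then have "[:1 / c:] * d = 1" using d(2) by (simp add: one_pCons)
  then show ?thesis using mult[OF d(1), of "[:1 / c:]"] by simp
qed

section \<open>Pompeiu property and common zeros\<close>

theorem theorem3p2:
  fixes k :: nat and \<K> :: "word set set"
  assumes "k \<ge> 2"
    and "finite \<K>"
    and "\<And>K. K \<in> \<K> \<Longrightarrow> K \<noteq> {} \<and> finite K \<and> radial_set k K"
  shows "pompeiu_property (free_group k) \<K> \<longleftrightarrow> (\<Inter>K\<in>\<K>. zero_set k (indicator K)) = {}"
proof
  have k: "k \<ge> 1" using assms(1) by simp
  show "(\<Inter>K\<in>\<K>. zero_set k (indicator K)) = {}" if pomp: "pompeiu_property (free_group k) \<K>"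
  proof (rule ccontr)
    assume "(\<Inter>K\<in>\<K>. zero_set k (indicator K)) \<noteq> {}"
    then obtain z where z: "\<And>K. K \<in> \<K> \<Longrightarrow> z \<in> zero_set k (indicator K)" by blast
    define f where "f = (\<lambda>x :: word. spherical k z (length x))"
    have eig: "nbr_sum k (sphere_sum k 0 f) g = z * sphere_sum k 0 f g"
      if g: "g \<in> carrier (free_group k)" for g
    proof -
      \<comment> \<open>\<open>sphere_sum k 0 f\<close> and \<open>f\<close> agree on the group,
        hence so do their neighbour sums.\<close>
      have "nbr_sum k (\<lambda>x. sphere_sum k 0 f x + (- 1) * f x) g = 0"
        using g by (intro nbr_sum_eq_0_on_carrier) (auto simp: sphere_sum_0)
      then have "nbr_sum k (sphere_sum k 0 f) g = nbr_sum k f g"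
        unfolding nbr_sum_add nbr_sum_mult by simp
      then show ?thesis
        using nbr_sum_spherical[OF k g, of z] g by (simp add: sphere_sum_0 f_def)
    qed
    have "(\<Sum>x\<in>g <#\<^bsub>free_group k\<^esub> K. f x) = 0"
      if K: "K \<in> \<K>" and g: "g \<in> carrier (free_group k)" for K g
    proof -
      obtain N where N: "finite N" "K = (\<Union>n\<in>N. sphere_F k n)"
        using radial_setE[OF k] assms(3)[OF K] by metis
      then have "poly (radii_poly k N) z = 0"
        using z[OF K] zero_set_radial[OF k] by simp
      then show ?thesis
        using sum_coset_radial[OF k N g] poly_op_eigenfunction[OF eig g] by simp
    qed
    then have "f [] = 0"
      using pomp by (simp add: pompeiu_property_def carrier_free_group)
    then show False by (simp add: f_def)
  qed
  show "pompeiu_property (free_group k) \<K>" if empty: "(\<Inter>K\<in>\<K>. zero_set k (indicator K)) = {}"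
    unfolding pompeiu_property_def
  proof (intro allI impI ballI)
    fix f :: "word \<Rightarrow> complex" and g
    assume vanish: "\<forall>K\<in>\<K>. \<forall>g\<in>carrier (free_group k). (\<Sum>x\<in>g <#\<^bsub>free_group k\<^esub> K. f x) = 0"
      and g: "g \<in> carrier (free_group k)"
    \<comment> \<open>The polynomials whose operators annihilate \<open>f\<close> on the group form
      an ideal, which contains every \<open>radii_poly k N\<close> coming from \<K>.\<close>
    define I where
      "I = {p. \<forall>g\<in>carrier (free_group k). poly_op k p (sphere_sum k 0 f) g = 0}"
    have "1 \<in> I"
    proof (rule complex_poly_ideal_unit)
      show "p + q \<in> I" if "p \<in> I" "q \<in> I" for p q
        using that by (simp add: I_def poly_op_add)
      show "p * q \<in> I" if "q \<in> I" for p q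
        using that poly_op_eq_0_on_carrier[of k "poly_op k q (sphere_sum k 0 f)"]
        by (simp add: I_def poly_op_mult)
      show "\<exists>p\<in>I. poly p z \<noteq> 0" for z
      proof -
        obtain K where K: "K \<in> \<K>" "z \<notin> zero_set k (indicator K)" using empty by blast
        obtain N where N: "finite N" "K = (\<Union>n\<in>N. sphere_F k n)"
          using radial_setE[OF k] assms(3)[OF K(1)] by metis
        have "radii_poly k N \<in> I"
          using vanish K(1) sum_coset_radial[OF k N, of _ f, symmetric] by (simp add: I_def)
        moreover have "poly (radii_poly k N) z \<noteq> 0"
          using K(2) zero_set_radial[OF k N] by simp
        ultimately show ?thesis by blast
      qed
    qed
    \<comment> \<open>\<open>p_poly k 0\<close> is the constant 1, whose operator is the
      identity.\<close>
    then have "poly_op k (p_poly k 0) (sphere_sum k 0 f) g = 0" using g by (simp add: I_def)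
    then show "f g = 0"
      using g sphere_sum_eq_poly_op[OF k, of 0 f] by (simp add: sphere_sum_0)
  qed
qed

end
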